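(* Let $A \in M_n(\mathbb{C})$ be a hermitian matrix and let $k$ be an integer with $1 \le k \leq n$. Then there is a subset $S \subset [n]$ with $|S| = k$ such that the $k\times k$ principal submatrix $A_S$ satisfies $$\lambda_{\max}(A_S) \leq \operatorname{max\,root}\,\chi^{(n-k)}[A].$$
   Context: $[n]=\{1,\dots,n\}$. $A_S$ denotes the principal submatrix of $A$ with rows and columns indexed by $S$ (so it has size $|S|$). $\lambda_{\max}$ denotes the largest eigenvalue. $\chi[A](x)=\det(xI-A)$ is the characteristic polynomial of $A$ and $\chi^{(j)}[A]$ is its $j$-th derivative in $x$. Since $A$ is hermitian, $\chi[A]$ and its non-constant derivatives are real rooted; $\operatorname{max\,root}$ denotes the largest root. *)

theory Defs
  imports
    Complex_Main
    "Jordan_Normal_Form.Char_Poly"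
    "Jordan_Normal_Form.Schur_Decomposition"
    "Jordan_Normal_Form.DL_Submatrix"
begin

definition hermitian_mat :: "complex mat \<Rightarrow> bool" where
  "hermitian_mat A \<longleftrightarrow> mat_adjoint A = A"

(* Intended for hermitian matrices of positive size: all eigenvalues are then real,
   so the set is the whole (finite, nonempty) spectrum. *)
definition lambda_max :: "complex mat \<Rightarrow> real" where
  "lambda_max A = Max {x. eigenvalue A (complex_of_real x)}"

(* Intended for non-constant real rooted polynomials: the set is then the finite,
   nonempty set of all complex roots. *)
definition max_root :: "complex poly \<Rightarrow> real" where
  "max_root p = Max {x. poly p (complex_of_real x) = 0}"

end

(* Write A_i for A with row and column i deleted, and call a complex polynomial upper stable if it
   has no root in the open upper half-plane; by the Gauss-Lucas argument, derivatives preserve this.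
   For Im z > 0 the polynomial chi[A] + z chi[A_i] = chi[A - z E_ii] is upper stable, because A is
   hermitian. Hence so are its derivatives, which forces the Wronskians
   chi[A_i]^(l) chi[A]^(l+1) - chi[A_i]^(l+1) chi[A]^(l) to be nonnegative on the real line.
   Now let mu exceed the largest root of chi[A]^(n-k), so that chi[A]^(l)(mu) > 0 for l >= n-k.
   As chi[A]' is the sum of the chi[A_i], some i has chi[A_i]^(n-k-1)(mu) > 0, and the Wronskian
   inequality, read from the top derivative downwards, makes all chi[A_i]^(l)(mu) with l >= n-k-1
   positive as well. Deleting indices in this way until k are left gives S with all derivatives of
   chi[A_S] positive at mu, so lambda_max(A_S) < mu. Only finitely many S occur, hence one of them
   works for all mu. *)

theory Submission
  imports Defs
begin

section \<open>Upper stable polynomials and real-rootedness\<close>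

abbreviation cpoly :: "real poly \<Rightarrow> complex poly" where
  "cpoly \<equiv> map_poly complex_of_real"

interpretation cpoly_hom: map_poly_inj_idom_hom complex_of_real ..

text \<open>The zero polynomial is excluded. For real coefficients the notion amounts to being
  nonzero and real rooted, since nonreal roots come in conjugate pairs.\<close>

definition upper_stable :: "complex poly \<Rightarrow> bool" where
  "upper_stable p \<longleftrightarrow> (\<forall>z. Im z > 0 \<longrightarrow> poly p z \<noteq> 0)"

lemma poly_cpoly_of_real [simp]: "poly (cpoly p) (complex_of_real x) = complex_of_real (poly p x)"
  by (simp add: of_real_hom.poly_map_poly)

lemma poly_cpoly_cnj: "poly (cpoly p) (cnj z) = cnj (poly (cpoly p) z)"
  by (induction p) (auto simp: of_real_hom.map_poly_pCons_hom)

lemma pderiv_linear_mult: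
  fixes q :: "'a::idom poly"
  shows "pderiv ([:- a, 1:] * q) = [:- a, 1:] * pderiv q + q"
  by (subst pderiv_mult) (simp add: pderiv_pCons del: mult_pCons_left)

text \<open>The logarithmic derivative is the sum of the \<open>1 / (z - a)\<close>, each with negative imaginary part.\<close>

lemma Im_log_deriv_prod_list:
  assumes "\<forall>a\<in>set as. Im a \<le> 0" "Im z > 0"
  defines "P \<equiv> (\<Prod>a\<leftarrow>as. [:- a, 1:])"
  shows "poly P z \<noteq> 0" "Im (poly (pderiv P) z / poly P z) \<le> 0"
    "as \<noteq> [] \<Longrightarrow> Im (poly (pderiv P) z / poly P z) < 0"
proof -
  have "poly P z \<noteq> 0 \<and> Im (poly (pderiv P) z / poly P z) \<le> 0 \<and>
    (as \<noteq> [] \<longrightarrow> Im (poly (pderiv P) z / poly P z) < 0)"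
    unfolding P_def using assms(1)
  proof (induction as)
    case Nil
    then show ?case by (simp add: pderiv_1)
  next
    case (Cons a as)
    let ?Q = "\<Prod>a\<leftarrow>as. [:- a, 1:]"
    have IH: "poly ?Q z \<noteq> 0" "Im (poly (pderiv ?Q) z / poly ?Q z) \<le> 0"
      using Cons by auto
    have im: "Im (z - a) > 0" using Cons.prems assms(2) by auto
    then have ne: "z - a \<noteq> 0" by auto
    have "poly (pderiv ([:- a, 1:] * ?Q)) z / poly ([:- a, 1:] * ?Q) z
        = poly (pderiv ?Q) z / poly ?Q z + 1 / (z - a)"
      using IH(1) ne unfolding pderiv_linear_mult poly_add poly_mult by (simp add: field_simps)
    moreover have "Im (1 / (z - a)) < 0"
      using im ne by (simp add: Im_divide divide_neg_pos sum_power2_gt_zero_iff complex_eq_iff)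
    ultimately have "Im (poly (pderiv ([:- a, 1:] * ?Q)) z / poly ([:- a, 1:] * ?Q) z) < 0"
      using IH(2) by simp
    moreover have "poly ([:- a, 1:] * ?Q) z \<noteq> 0"
      using IH(1) ne by simp
    ultimately show ?case by simp
  qed
  then show "poly P z \<noteq> 0" "Im (poly (pderiv P) z / poly P z) \<le> 0"
    "as \<noteq> [] \<Longrightarrow> Im (poly (pderiv P) z / poly P z) < 0" by blast+
qed

text \<open>Positive degree supplies at least one root, so the logarithmic derivative has strictly
  negative imaginary part on the upper half-plane and cannot vanish there.\<close>

lemma upper_stable_pderiv:
  assumes "upper_stable p" "degree p > 0"
  shows "upper_stable (pderiv p)"
  unfolding upper_stable_def
proof (intro allI impI)
  fix z :: complex assume z: "Im z > 0"
  obtain as where p: "Polynomial.smult (lead_coeff p) (\<Prod>a\<leftarrow>as. [:- a, 1:]) = p"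
    and len: "length as = degree p"
    using fundamental_theorem_algebra_factorized[of p] by blast
  let ?P = "\<Prod>a\<leftarrow>as. [:- a, 1:]"
  have lc: "lead_coeff p \<noteq> 0" using assms(2) by auto
  have "poly p a = 0" if "a \<in> set as" for a
    using that by (subst p[symmetric]) (auto simp: poly_prod_list o_def prod_list_zero_iff)
  then have im: "\<forall>a\<in>set as. Im a \<le> 0"
    using assms(1) unfolding upper_stable_def by (meson not_le)
  have "as \<noteq> []" using len assms(2) by auto
  then have "poly (pderiv ?P) z \<noteq> 0"
    using Im_log_deriv_prod_list(3)[OF im z] by auto
  then show "poly (pderiv p) z \<noteq> 0"
    using lc by (subst p[symmetric]) (simp add: pderiv_smult)
qed

lemma upper_stable_higher_pderiv:
  assumes "upper_stable p" "l \<le> degree p"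
  shows "upper_stable ((pderiv ^^ l) p)"
  using assms(2)
proof (induction l)
  case 0
  then show ?case using assms(1) by simp
next
  case (Suc l)
  then show ?case by (auto intro!: upper_stable_pderiv simp: degree_higher_pderiv)
qed

lemma upper_stable_real_root:
  assumes "upper_stable (cpoly f)" "poly (cpoly f) z = 0"
  shows "z = complex_of_real (Re z)"
proof -
  have "poly (cpoly f) (cnj z) = 0" using assms(2) by (simp add: poly_cpoly_cnj)
  then have "\<not> Im z > 0" "\<not> Im (cnj z) > 0"
    using assms unfolding upper_stable_def by blast+
  then show ?thesis by (simp add: complex_eq_iff)
qed

lemma cpoly_prod_list:
  "cpoly (\<Prod>r\<leftarrow>rs. [:- r, 1:]) = (\<Prod>r\<leftarrow>rs. [:- complex_of_real r, 1:])"
  by (induction rs) (simp_all add: cpoly_hom.hom_mult of_real_hom.map_poly_pCons_hom del: mult_pCons_left)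

text \<open>All complex roots are real, so the complex factorization is the image of a real one, and
  injectivity of \<open>cpoly\<close> pulls it back.\<close>

lemma upper_stable_real_splits:
  assumes "upper_stable (cpoly f)"
  obtains rs where "f = Polynomial.smult (lead_coeff f) (\<Prod>r\<leftarrow>rs. [:- r, 1:])" "length rs = degree f"
proof (cases "f = 0")
  case True
  then show ?thesis using that[of "[]"] by simp
next
  case False
  obtain as where p: "Polynomial.smult (lead_coeff (cpoly f)) (\<Prod>a\<leftarrow>as. [:- a, 1:]) = cpoly f"
    and len: "length as = degree (cpoly f)"
    using fundamental_theorem_algebra_factorized[of "cpoly f"] by blast
  have "poly (cpoly f) a = 0" if "a \<in> set as" for a
    using that by (subst p[symmetric]) (auto simp: poly_prod_list o_def prod_list_zero_iff)
  then have "map (\<lambda>a. complex_of_real (Re a)) as = as"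
    using upper_stable_real_root[OF assms] by (intro map_idI) metis
  moreover define rs where "rs = map Re as"
  have "(\<Prod>r\<leftarrow>rs. [:- complex_of_real r, 1:]) =
      (\<Prod>a\<leftarrow>map (\<lambda>a. complex_of_real (Re a)) as. [:- a, 1:])"
    by (simp add: rs_def o_def)
  ultimately have "(\<Prod>a\<leftarrow>as. [:- a, 1:]) = (\<Prod>r\<leftarrow>rs. [:- complex_of_real r, 1:])"
    by (simp only:)
  then have "cpoly f = cpoly (Polynomial.smult (lead_coeff f) (\<Prod>r\<leftarrow>rs. [:- r, 1:]))"
    using p by (simp add: cpoly_prod_list of_real_hom.map_poly_hom_smult)
  then have "f = Polynomial.smult (lead_coeff f) (\<Prod>r\<leftarrow>rs. [:- r, 1:])"
    by (simp only: cpoly_hom.eq_iff)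
  moreover have "length rs = degree f" using len by (simp add: rs_def)
  ultimately show ?thesis by (rule that)
qed

section \<open>Signs of derivatives to the right of the roots, and Wronskians\<close>

text \<open>Leibniz rule with a factor whose second derivative vanishes. For \<open>l = 0\<close>
  the truncated \<open>l - 1\<close> is harmless, as its coefficient is zero.\<close>

lemma higher_pderiv_linear_mult:
  fixes g :: "'a::idom poly"
  shows "poly ((pderiv ^^ l) ([:- r, 1:] * g)) x =
    (x - r) * poly ((pderiv ^^ l) g) x + of_nat l * poly ((pderiv ^^ (l - 1)) g) x"
proof -
  define h where "h = [:- r, 1:]"
  have h: "pderiv (h * q) = h * pderiv q + q" for q
    unfolding h_def by (rule pderiv_linear_mult)
  have "(pderiv ^^ l) (h * g) = h * (pderiv ^^ l) g + of_nat l * (pderiv ^^ (l - 1)) g"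
  proof (induction l)
    case (Suc l)
    then show ?case
      by (cases l) (simp_all add: h pderiv_mult[of "of_nat _"] pderiv_add ring_distribs)
  qed simp
  moreover have "poly h x = x - r" by (simp add: h_def)
  ultimately show ?thesis unfolding h_def[symmetric] by simp
qed

lemma higher_pderiv_prod_list_pos:
  fixes rs :: "real list"
  assumes "\<forall>r\<in>set rs. r < \<mu>" "l \<le> length rs"
  shows "poly ((pderiv ^^ l) (\<Prod>r\<leftarrow>rs. [:- r, 1:])) \<mu> > 0"
proof -
  \<comment> \<open>Nonnegativity for every order is carried through the induction, because one of
    the two Leibniz summands may vanish.\<close>
  have "poly ((pderiv ^^ l) (\<Prod>r\<leftarrow>rs. [:- r, 1:])) \<mu> \<ge> 0 \<and>
    (l \<le> length rs \<longrightarrow> poly ((pderiv ^^ l) (\<Prod>r\<leftarrow>rs. [:- r, 1:])) \<mu> > 0)"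
    using assms(1)
  proof (induction rs arbitrary: l)
    case Nil
    have "(pderiv ^^ Suc l) (1 :: real poly) = 0" for l
      by (induction l) (auto simp: pderiv_1)
    then show ?case by (cases l) (simp_all del: funpow.simps)
  next
    case (Cons r rs)
    let ?g = "\<Prod>r\<leftarrow>rs. [:- r, 1:]"
    have r: "\<mu> - r > 0" and rs: "\<forall>r\<in>set rs. r < \<mu>" using Cons.prems by auto
    note IH = Cons.IH[OF rs]
    show ?case
      unfolding list.map prod_list.Cons higher_pderiv_linear_mult
    proof (intro conjI impI)
      show "0 \<le> (\<mu> - r) * poly ((pderiv ^^ l) ?g) \<mu> + of_nat l * poly ((pderiv ^^ (l - 1)) ?g) \<mu>"
        using r IH by (intro add_nonneg_nonneg mult_nonneg_nonneg) auto
      assume l: "l \<le> length (r # rs)"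
      show "0 < (\<mu> - r) * poly ((pderiv ^^ l) ?g) \<mu> + of_nat l * poly ((pderiv ^^ (l - 1)) ?g) \<mu>"
      \<comment> \<open>Up to order \<open>length rs\<close> the first summand is positive. At order
        \<open>length rs + 1\<close> the second one is, since then
        \<open>l - 1 = length rs\<close>.\<close>
      proof (cases "l \<le> length rs")
        case True
        then show ?thesis
          using r IH by (intro add_pos_nonneg mult_pos_pos mult_nonneg_nonneg) auto
      next
        case False
        then show ?thesis
          using r IH l by (intro add_nonneg_pos mult_pos_pos mult_nonneg_nonneg) auto
      qed
    qed
  qed
  then show ?thesis using assms(2) by blast
qed

text \<open>Induction on the degree: applied to \<open>pderiv p\<close>, the claim makes the
  derivative nonnegative to the right of \<mu>, and the mean value theorem concludes.\<close>

lemma poly_mono_of_higher_pderiv_nonneg: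
  fixes p :: "real poly"
  assumes "\<And>l. poly ((pderiv ^^ l) p) \<mu> \<ge> 0" "x \<ge> \<mu>"
  shows "poly p x \<ge> poly p \<mu>"
  using assms
proof (induction "degree p" arbitrary: p x rule: less_induct)
  case less
  show ?case
  proof (cases "degree p = 0 \<or> x = \<mu>")
    case True
    then show ?thesis by (auto elim!: degree_eq_zeroE)
  next
    case False
    have *: "poly (pderiv p) y \<ge> 0" if "y \<ge> \<mu>" for y
    proof -
      have "poly (pderiv p) y \<ge> poly (pderiv p) \<mu>"
      proof (rule less.hyps)
        show "degree (pderiv p) < degree p" using False by (simp add: degree_pderiv)
        show "poly ((pderiv ^^ l) (pderiv p)) \<mu> \<ge> 0" for l
          using less.prems(1)[of "Suc l"] by (simp add: funpow_swap1)
      qed (use that in auto)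
      then show ?thesis using less.prems(1)[of 1] by simp
    qed
    obtain y where "y > \<mu>" "poly p x - poly p \<mu> = (x - \<mu>) * poly (pderiv p) y"
      using poly_MVT[of \<mu> x p] False less.prems(2) by auto
    moreover have "(x - \<mu>) * poly (pderiv p) y \<ge> 0"
      using *[of y] \<open>y > \<mu>\<close> less.prems(2) by (intro mult_nonneg_nonneg) auto
    ultimately show ?thesis by linarith
  qed
qed

text \<open>The hypothesis says that \<open>f / g\<close> maps the upper half-plane to its closure, i.e.
  \<open>Im (f * cnj g) \<ge> 0\<close> there. This expression vanishes on the real line, and its
  derivative in the imaginary direction is the Wronskian.\<close>

lemma wronskian_nonneg:
  fixes f g :: "real poly"
  assumes "\<And>z x. Im z > 0 \<Longrightarrow> Im x > 0 \<Longrightarrow> poly (cpoly f) x + z * poly (cpoly g) x \<noteq> 0"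
  shows "poly (pderiv f) x * poly g x - poly f x * poly (pderiv g) x \<ge> 0"
proof -
  let ?F = "cpoly f" and ?G = "cpoly g"
  \<comment> \<open>For real \<open>w\<close> the two arguments are conjugate, so \<open>K w\<close>
    is the value of \<open>?F\<close> times the conjugate value of \<open>?G\<close>. Written this
    way it is complex differentiable in \<open>w\<close>.\<close>
  define K where "K = (\<lambda>w. poly ?F (of_real x + \<i> * w) * poly ?G (of_real x - \<i> * w))"
  define D where "D = poly (pderiv f) x * poly g x - poly f x * poly (pderiv g) x"
  have "DERIV (\<lambda>w. poly ?F (of_real x + \<i> * w)) 0 :> poly (pderiv ?F) (of_real x + \<i> * 0) * \<i>"
    by (rule DERIV_chain2[OF poly_DERIV]) (auto intro!: derivative_eq_intros)
  moreover have "DERIV (\<lambda>w. poly ?G (of_real x - \<i> * w)) 0 :> poly (pderiv ?G) (of_real x - \<i> * 0) * (- \<i>)"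
    by (rule DERIV_chain2[OF poly_DERIV]) (auto intro!: derivative_eq_intros)
  ultimately have "DERIV K 0 :> \<i> * of_real D"
    unfolding K_def D_def
    by (rule DERIV_cong[OF DERIV_mult])
      (simp add: of_real_hom.map_poly_pderiv[symmetric] algebra_simps)
  then have "((\<lambda>h. (K h - K 0) / h) \<longlongrightarrow> \<i> * of_real D) (at 0)"
    by (auto simp: DERIV_def)
  moreover have "filterlim complex_of_real (at 0) (at_right 0)"
    unfolding filterlim_at
    by (auto intro!: tendsto_eq_intros simp: eventually_at_filter)
  ultimately have "((\<lambda>e. (K (of_real e) - K 0) / of_real e) \<longlongrightarrow> \<i> * of_real D) (at_right (0::real))"
    by (rule filterlim_compose)
  then have "((\<lambda>e. Im ((K (of_real e) - K 0) / of_real e)) \<longlongrightarrow> Im (\<i> * of_real D)) (at_right (0::real))"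
    by (rule tendsto_Im)
  moreover have "\<forall>\<^sub>F e in at_right (0::real). Im ((K (of_real e) - K 0) / of_real e) \<ge> 0"
    unfolding eventually_at_filter
  proof (intro always_eventually allI impI)
    fix e :: real assume "e \<noteq> 0" "e \<in> {0<..}"
    then have e: "e > 0" by simp
    define u where "u = complex_of_real x + \<i> * of_real e"
    have "of_real x - \<i> * of_real e = cnj u" by (simp add: u_def)
    then have K: "K (of_real e) = poly ?F u * cnj (poly ?G u)"
      by (simp add: K_def u_def[symmetric] poly_cpoly_cnj)
    have "Im (K (of_real e)) \<ge> 0"
    proof (rule ccontr)
      assume neg: "\<not> ?thesis"
      then have g: "poly ?G u \<noteq> 0" by (auto simp: K)
      have "poly ?F u / poly ?G u = K (of_real e) / of_real ((cmod (poly ?G u))\<^sup>2)"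
        using g unfolding K complex_norm_square by simp
      \<comment> \<open>A negative imaginary part of \<open>K\<close> would put
        \<open>z = - ?F / ?G\<close>, evaluated at \<open>u\<close>, into the upper half-plane, and
        this \<open>z\<close> makes the forbidden sum vanish.\<close>
      then have "Im (- (poly ?F u / poly ?G u)) > 0"
        using neg g by (simp add: divide_neg_pos)
      moreover have "Im u > 0" using e by (simp add: u_def)
      ultimately have "poly ?F u + (- (poly ?F u / poly ?G u)) * poly ?G u \<noteq> 0"
        using assms by blast
      then show False using g by simp
    qed
    moreover have "Im (K 0) = 0" by (simp add: K_def)
    ultimately show "Im ((K (of_real e) - K 0) / of_real e) \<ge> 0" using e by simp
  qed
  ultimately have "Im (\<i> * of_real D) \<ge> 0"
    by (intro tendsto_lowerbound) auto
  then show ?thesis by (simp add: D_def)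
qed


section \<open>Hermitian matrices and rank-one diagonal updates\<close>

lemma hermitian_mat_index:
  assumes "A \<in> carrier_mat n n" "hermitian_mat A" "i < n" "j < n"
  shows "cnj (A $$ (i, j)) = A $$ (j, i)"
proof -
  have "mat_adjoint A $$ (j, i) = cnj (A $$ (i, j))"
    using assms by (simp add: mat_adjoint_def mat_of_rows_index)
  then show ?thesis using assms(2) by (simp add: hermitian_mat_def)
qed

lemma hermitian_matI:
  assumes "A \<in> carrier_mat n n" "\<And>i j. i < n \<Longrightarrow> j < n \<Longrightarrow> cnj (A $$ (i, j)) = A $$ (j, i)"
  shows "hermitian_mat A"
  unfolding hermitian_mat_def
  by (rule eq_matI) (use assms in \<open>auto simp: mat_adjoint_def mat_of_rows_index\<close>)

lemma hermitian_mat_delete: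
  assumes "A \<in> carrier_mat n n" "hermitian_mat A"
  shows "hermitian_mat (mat_delete A i i)"
proof (rule hermitian_matI)
  show "mat_delete A i i \<in> carrier_mat (n - 1) (n - 1)"
    using assms(1) by (rule mat_delete_carrier)
  show "cnj (mat_delete A i i $$ (r, c)) = mat_delete A i i $$ (c, r)" if "r < n - 1" "c < n - 1" for r c
    using that assms(1) by (auto simp: mat_delete_def intro!: hermitian_mat_index[OF assms])
qed

lemma hermitian_quadratic_form_real:
  assumes "A \<in> carrier_mat n n" "hermitian_mat A"
  shows "Im (\<Sum>r<n. \<Sum>c<n. cnj (v r) * A $$ (r, c) * v c) = 0"
proof -
  let ?s = "\<Sum>r<n. \<Sum>c<n. cnj (v r) * A $$ (r, c) * v c"
  have "cnj ?s = (\<Sum>r<n. \<Sum>c<n. cnj (v c) * A $$ (c, r) * v r)"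
    by (auto simp: hermitian_mat_index[OF assms] mult_ac intro!: sum.cong)
  also have "\<dots> = ?s" by (rule sum.swap)
  finally have "?s \<in> \<real>" by (simp only: Reals_cnj_iff)
  then show ?thesis by (rule complex_is_Real_iff[THEN iffD1])
qed

text \<open>Multiplying the eigenvector equation of \<open>A - z E_ii\<close> by the conjugate
  transpose of \<open>v\<close> gives \<open>v* A v = x |v|^2 + z |v_i|^2\<close>, whose left side
  is real.\<close>

lemma eigenvalue_rank_one_update_Im:
  assumes A: "A \<in> carrier_mat n n" "hermitian_mat A" and i: "i < n"
    and x: "eigenvalue (mat n n (\<lambda>(r, c). A $$ (r, c) - (if r = i \<and> c = i then z else 0))) x"
  obtains v where "v \<noteq> 0\<^sub>v n" "v \<in> carrier_vec n"
    "Im x * (\<Sum>r<n. (cmod (v $ r))\<^sup>2) + Im z * (cmod (v $ i))\<^sup>2 = 0"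
proof -
  let ?B = "mat n n (\<lambda>(r, c). A $$ (r, c) - (if r = i \<and> c = i then z else 0))"
  obtain v where v: "v \<in> carrier_vec n" "v \<noteq> 0\<^sub>v n" "?B *\<^sub>v v = x \<cdot>\<^sub>v v"
    using x unfolding eigenvalue_def eigenvector_def by auto
  have row: "(\<Sum>c<n. A $$ (r, c) * v $ c) = x * v $ r + (if r = i then z * v $ i else 0)" if r: "r < n" for r
  proof -
    have "x * v $ r = (?B *\<^sub>v v) $ r" using v r by simp
    also have "\<dots> = (\<Sum>c<n. A $$ (r, c) * v $ c - (if r = i \<and> c = i then z * v $ c else 0))"
      using v(1) r by (auto simp: scalar_prod_def lessThan_atLeast0 algebra_simps intro!: sum.cong)
    also have "\<dots> = (\<Sum>c<n. A $$ (r, c) * v $ c) - (if r = i then z * v $ i else 0)"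
      using i by (simp add: sum_subtractf sum.delta')
    finally show ?thesis by simp
  qed
  have "(\<Sum>r<n. \<Sum>c<n. cnj (v $ r) * A $$ (r, c) * v $ c) =
      (\<Sum>r<n. cnj (v $ r) * (x * v $ r + (if r = i then z * v $ i else 0)))"
    by (simp add: row[symmetric] sum_distrib_left mult.assoc)
  also have "\<dots> = (\<Sum>r<n. x * complex_of_real ((cmod (v $ r))\<^sup>2) + (if r = i then z * complex_of_real ((cmod (v $ i))\<^sup>2) else 0))"
    by (intro sum.cong) (auto simp: complex_norm_square algebra_simps simp del: of_real_power)
  also have "\<dots> = x * complex_of_real (\<Sum>r<n. (cmod (v $ r))\<^sup>2) + z * complex_of_real ((cmod (v $ i))\<^sup>2)"
    using i by (simp add: sum.distrib sum_distrib_left)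
  finally have "Im x * (\<Sum>r<n. (cmod (v $ r))\<^sup>2) + Im z * (cmod (v $ i))\<^sup>2 = 0"
    using hermitian_quadratic_form_real[OF A, of "($) v"] by simp
  then show ?thesis using that v by blast
qed

lemma sum_cmod_square_pos:
  assumes "v \<in> carrier_vec n" "v \<noteq> 0\<^sub>v n"
  shows "(\<Sum>r<n. (cmod (v $ r))\<^sup>2) > 0"
proof -
  obtain r where "r < n" "v $ r \<noteq> 0" using assms by (metis carrier_vecD eq_vecI index_zero_vec(1,2))
  then show ?thesis by (intro sum_pos2[of _ r]) auto
qed

text \<open>Laplace expansion along row \<open>i\<close>: the update changes only the diagonal entry
  of that row, and the cofactors of the row do not involve it.\<close>

lemma char_poly_rank_one_update:
  fixes A :: "'a::idom mat"
  assumes A: "A \<in> carrier_mat n n" and i: "i < n"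
  shows "char_poly (mat n n (\<lambda>(r, c). A $$ (r, c) - (if r = i \<and> c = i then z else 0))) =
    char_poly A + Polynomial.smult z (char_poly (mat_delete A i i))"
proof -
  let ?B = "mat n n (\<lambda>(r, c). A $$ (r, c) - (if r = i \<and> c = i then z else 0))"
  let ?M = "char_poly_matrix A" and ?N = "char_poly_matrix ?B"
  have M: "?M \<in> carrier_mat n n" and N: "?N \<in> carrier_mat n n" using A by auto
  have del: "mat_delete ?N i j = mat_delete ?M i j" for j
    by (rule eq_matI) (use A i in \<open>auto simp: mat_delete_def char_poly_matrix_def\<close>)
  have cof: "cofactor ?N i j = cofactor ?M i j" for j
    by (simp add: cofactor_def del)
  have entry: "?N $$ (i, j) = ?M $$ (i, j) + (if j = i then [:z:] else 0)" if "j < n" for j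
    using A i that by (auto simp: char_poly_matrix_def)
  have delA: "mat_delete ?M i i = char_poly_matrix (mat_delete A i i)"
    by (rule eq_matI) (use A i in \<open>auto simp: mat_delete_def char_poly_matrix_def\<close>)
  have "char_poly ?B = (\<Sum>j<n. ?N $$ (i, j) * cofactor ?N i j)"
    unfolding char_poly_def by (rule laplace_expansion_row[OF N i])
  also have "\<dots> = (\<Sum>j<n. ?M $$ (i, j) * cofactor ?M i j + (if j = i then [:z:] * cofactor ?M i i else 0))"
    by (intro sum.cong) (auto simp: cof entry distrib_right)
  also have "\<dots> = char_poly A + [:z:] * cofactor ?M i i"
    using i unfolding sum.distrib char_poly_def laplace_expansion_row[OF M i] by simp
  also have "cofactor ?M i i = char_poly (mat_delete A i i)"
    by (simp add: cofactor_def delA char_poly_def)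
  finally show ?thesis by simp
qed

text \<open>A root \<open>x\<close> in the upper half-plane would be an eigenvalue of
  \<open>A - z E_ii\<close>, making a positive and a nonnegative number add up to zero.\<close>

lemma upper_stable_char_poly_rank_one_update:
  assumes A: "A \<in> carrier_mat n n" "hermitian_mat A" and i: "i < n" and z: "Im z \<ge> 0"
  shows "upper_stable (char_poly A + Polynomial.smult z (char_poly (mat_delete A i i)))"
  unfolding upper_stable_def
proof (intro allI impI notI)
  fix x :: complex assume x: "Im x > 0"
    and root: "poly (char_poly A + Polynomial.smult z (char_poly (mat_delete A i i))) x = 0"
  let ?B = "mat n n (\<lambda>(r, c). A $$ (r, c) - (if r = i \<and> c = i then z else 0))"
  have "eigenvalue ?B x"
    using root by (subst eigenvalue_root_char_poly[of _ n]) (simp_all add: char_poly_rank_one_update[OF A(1) i])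
  then obtain v where v: "v \<noteq> 0\<^sub>v n" "v \<in> carrier_vec n"
    "Im x * (\<Sum>r<n. (cmod (v $ r))\<^sup>2) + Im z * (cmod (v $ i))\<^sup>2 = 0"
    by (rule eigenvalue_rank_one_update_Im[OF A i])
  have "Im x * (\<Sum>r<n. (cmod (v $ r))\<^sup>2) > 0"
    using x sum_cmod_square_pos[OF v(2,1)] by simp
  moreover have "Im z * (cmod (v $ i))\<^sup>2 \<ge> 0" using z by simp
  ultimately show False using v(3) by simp
qed

lemma hermitian_eigenvalue_real:
  assumes A: "A \<in> carrier_mat n n" "hermitian_mat A" and x: "eigenvalue A x"
  shows "Im x = 0"
proof -
  have n: "0 < n" using eigenvalue_imp_nonzero_dim[OF A(1) x] .
  \<comment> \<open>The update with \<open>z = 0\<close> leaves \<open>A\<close> unchanged, so the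
    identity for imaginary parts applies to \<open>A\<close> itself.\<close>
  have "mat n n (\<lambda>(r, c). A $$ (r, c) - (if r = 0 \<and> c = 0 then 0 else 0)) = A"
    by (rule eq_matI) (use A in auto)
  then obtain v where v: "v \<noteq> 0\<^sub>v n" "v \<in> carrier_vec n"
    "Im x * (\<Sum>r<n. (cmod (v $ r))\<^sup>2) + Im 0 * (cmod (v $ 0))\<^sup>2 = 0"
    using eigenvalue_rank_one_update_Im[OF A n, of 0 x] x by metis
  then show ?thesis using sum_cmod_square_pos[OF v(2,1)] by simp
qed

lemma hermitian_char_poly:
  assumes A: "A \<in> carrier_mat n n" "hermitian_mat A"
  obtains p where "char_poly A = cpoly p" "degree p = n" "lead_coeff p = 1" "upper_stable (cpoly p)"
proof -
  obtain as where as: "char_poly A = (\<Prod>a\<leftarrow>as. [:- a, 1:])"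
    using char_poly_factorized[OF A(1)] by blast
  have im: "Im a = 0" if "poly (char_poly A) a = 0" for a
    using that hermitian_eigenvalue_real[OF A] by (simp add: eigenvalue_root_char_poly[OF A(1)])
  have "Im a = 0" if "a \<in> set as" for a
    using that by (intro im) (auto simp: as poly_prod_list o_def prod_list_zero_iff)
  then have "map (\<lambda>a. complex_of_real (Re a)) as = as"
    by (intro map_idI) (simp add: complex_eq_iff)
  moreover define rs where "rs = map Re as"
  have "(\<Prod>r\<leftarrow>rs. [:- complex_of_real r, 1:]) =
      (\<Prod>a\<leftarrow>map (\<lambda>a. complex_of_real (Re a)) as. [:- a, 1:])"
    by (simp add: rs_def o_def)
  ultimately have "(\<Prod>a\<leftarrow>as. [:- a, 1:]) = (\<Prod>r\<leftarrow>rs. [:- complex_of_real r, 1:])"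
    by (simp only:)
  then have p: "char_poly A = cpoly (\<Prod>r\<leftarrow>rs. [:- r, 1:])" (is "_ = cpoly ?p")
    by (simp only: as cpoly_prod_list)
  have "degree ?p = n" "lead_coeff ?p = 1"
    using degree_monic_char_poly[OF A(1)] unfolding p by auto
  moreover have "upper_stable (cpoly ?p)"
    using im unfolding p[symmetric] upper_stable_def by (metis less_irrefl)
  ultimately show ?thesis using that p by blast
qed


section \<open>Principal submatrices and deletion of an index\<close>

text \<open>\<open>pick S j\<close> is the element of \<open>S\<close> with exactly \<open>j\<close>
  smaller ones in \<open>S\<close>, a count that strictly monotone maps preserve.\<close>

lemma pick_image_strict_mono:
  assumes f: "strict_mono f" and j: "j < card S"
  shows "pick (f ` S) j = f (pick S j)"
proof -
  have "{a \<in> f ` S. a < f (pick S j)} = f ` {a \<in> S. a < pick S j}"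
    using strict_mono_less[OF f] by auto
  then have "card {a \<in> f ` S. a < f (pick S j)} = j"
    using j by (simp add: card_image[OF inj_on_subset[OF strict_mono_imp_inj_on[OF f] subset_UNIV]] card_pick_le)
  then show ?thesis
    using pick_card_in_set[of "f (pick S j)" "f ` S"] pick_in_set_le[OF j] by simp
qed

lemma pick_lessThan: "j < n \<Longrightarrow> pick {..<n} j = j"
  using pick_card_in_set[of j "{..<n}"] by (simp add: Collect_conj_eq lessThan_def[symmetric] inf_absorb2)

lemma submatrix_subset_carrier:
  assumes "A \<in> carrier_mat n n" "S \<subseteq> {..<n}"
  shows "submatrix A S S \<in> carrier_mat (card S) (card S)"
    "\<And>r c. r < card S \<Longrightarrow> c < card S \<Longrightarrow> submatrix A S S $$ (r, c) = A $$ (pick S r, pick S c)"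
proof -
  have "{i. i < n \<and> i \<in> S} = S" using assms(2) by auto
  then show "submatrix A S S \<in> carrier_mat (card S) (card S)"
    "\<And>r c. r < card S \<Longrightarrow> c < card S \<Longrightarrow> submatrix A S S $$ (r, c) = A $$ (pick S r, pick S c)"
    using assms(1) by (auto simp: submatrix_def)
qed

lemma hermitian_submatrix:
  assumes "A \<in> carrier_mat n n" "hermitian_mat A" "S \<subseteq> {..<n}"
  shows "hermitian_mat (submatrix A S S)"
proof (rule hermitian_matI[OF submatrix_subset_carrier(1)[OF assms(1,3)]])
  show "cnj (submatrix A S S $$ (r, c)) = submatrix A S S $$ (c, r)" if "r < card S" "c < card S" for r c
    using that assms(3) pick_in_set_le[of r S] pick_in_set_le[of c S]
    by (auto simp: submatrix_subset_carrier(2)[OF assms(1,3)] intro!: hermitian_mat_index[OF assms(1,2)])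
qed

lemma strict_mono_insert_index: "strict_mono (insert_index i)"
  by (rule strict_monoI) (auto simp: insert_index_def)

text \<open>\<open>insert_index i\<close> skips \<open>i\<close> and so translates positions in the
  smaller matrix back to positions in \<open>A\<close>. This lifts an index set found after a
  deletion.\<close>

lemma submatrix_mat_delete:
  assumes A: "A \<in> carrier_mat n n" and S: "S \<subseteq> {..<n - 1}" and i: "i < n"
  shows "insert_index i ` S \<subseteq> {..<n}" "card (insert_index i ` S) = card S"
    "submatrix (mat_delete A i i) S S = submatrix A (insert_index i ` S) (insert_index i ` S)"
proof -
  let ?f = "insert_index i"
  show sub: "?f ` S \<subseteq> {..<n}" using S i by (auto simp: insert_index_def)
  show card: "card (?f ` S) = card S"
    by (intro card_image inj_on_subset[OF strict_mono_imp_inj_on[OF strict_mono_insert_index] subset_UNIV])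
  have D: "mat_delete A i i \<in> carrier_mat (n - 1) (n - 1)" using A by (rule mat_delete_carrier)
  show "submatrix (mat_delete A i i) S S = submatrix A (?f ` S) (?f ` S)"
  proof (rule eq_matI)
    fix r c assume "r < dim_row (submatrix A (?f ` S) (?f ` S))" "c < dim_col (submatrix A (?f ` S) (?f ` S))"
    then have r: "r < card S" and c: "c < card S"
      using submatrix_subset_carrier(1)[OF A sub] card by auto
    have "pick S r < n - 1" "pick S c < n - 1" using S pick_in_set_le r c by blast+
    then show "submatrix (mat_delete A i i) S S $$ (r, c) = submatrix A (?f ` S) (?f ` S) $$ (r, c)"
      using A r c by (simp add: submatrix_subset_carrier(2)[OF D S] submatrix_subset_carrier(2)[OF A sub] card
          pick_image_strict_mono[OF strict_mono_insert_index])
        (simp add: mat_delete_def insert_index_def)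
  qed (use submatrix_subset_carrier(1)[OF A sub] submatrix_subset_carrier(1)[OF D S] card in auto)
qed

section \<open>Deleting indices while derivatives stay positive\<close>

lemma higher_pderiv_wronskian_nonneg:
  assumes A: "A \<in> carrier_mat n n" "hermitian_mat A" and i: "i < n" and l: "l < n"
    and p: "char_poly A = cpoly p" and q: "char_poly (mat_delete A i i) = cpoly q"
  shows "poly ((pderiv ^^ Suc l) p) x * poly ((pderiv ^^ l) q) x \<ge>
    poly ((pderiv ^^ l) p) x * poly ((pderiv ^^ Suc l) q) x"
proof -
  have "poly (cpoly ((pderiv ^^ l) p)) w + z * poly (cpoly ((pderiv ^^ l) q)) w \<noteq> 0"
    if "Im z > 0" "Im w > 0" for z w
  proof -
    let ?h = "char_poly A + Polynomial.smult z (char_poly (mat_delete A i i))"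
    \<comment> \<open>The added term has degree below \<open>n\<close>, so \<open>?h\<close> keeps
      degree \<open>n\<close> and its \<open>l\<close>-th derivative is still upper stable.\<close>
    have "degree (Polynomial.smult z (char_poly (mat_delete A i i))) < n"
      using degree_monic_char_poly[OF mat_delete_carrier[OF A(1)], of i i] i
      by (intro le_less_trans[OF degree_smult_le]) auto
    then have "degree ?h = n"
      using degree_monic_char_poly[OF A(1)] by (simp add: degree_add_eq_left)
    then have "upper_stable ((pderiv ^^ l) ?h)"
      using l that(1) by (intro upper_stable_higher_pderiv upper_stable_char_poly_rank_one_update[OF A i]) auto
    then have "poly ((pderiv ^^ l) ?h) w \<noteq> 0"
      using that(2) by (simp add: upper_stable_def)
    then show ?thesis
      by (simp add: p q higher_pderiv_add higher_pderiv_smult of_real_hom.map_poly_higher_pderiv)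
  qed
  from wronskian_nonneg[OF this] show ?thesis by simp
qed

lemma higher_pderiv_lead_coeff_pos:
  fixes p :: "real poly"
  assumes "lead_coeff p = 1" "l \<le> degree p"
  shows "lead_coeff ((pderiv ^^ l) p) > 0"
  using assms by (simp add: degree_higher_pderiv coeff_higher_pderiv pochhammer_pos)

lemma exists_mat_delete_higher_pderiv_pos:
  assumes A: "A \<in> carrier_mat n n" "hermitian_mat A" and k: "k < n"
    and pos: "\<And>l. n - k \<le> l \<Longrightarrow> l \<le> n \<Longrightarrow> Re (poly ((pderiv ^^ l) (char_poly A)) (of_real \<mu>)) > 0"
  obtains i where "i < n" "\<And>l. n - 1 - k \<le> l \<Longrightarrow> l \<le> n - 1 \<Longrightarrow>
    Re (poly ((pderiv ^^ l) (char_poly (mat_delete A i i))) (of_real \<mu>)) > 0"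
proof -
  obtain p where p: "char_poly A = cpoly p" using hermitian_char_poly[OF A] by blast
  have "\<exists>q. char_poly (mat_delete A i i) = cpoly q \<and> degree q = n - 1 \<and> lead_coeff q = 1" for i
    using hermitian_char_poly[OF mat_delete_carrier[OF A(1)] hermitian_mat_delete[OF A]] by metis
  then obtain q where q: "\<And>i. char_poly (mat_delete A i i) = cpoly (q i)"
    and deg: "\<And>i. degree (q i) = n - 1" and lc: "\<And>i. lead_coeff (q i) = 1"
    by metis
  have ppos: "poly ((pderiv ^^ l) p) \<mu> > 0" if "n - k \<le> l" "l \<le> n" for l
    using pos[OF that] by (simp add: p of_real_hom.map_poly_higher_pderiv[symmetric])
  \<comment> \<open>The lowest order required of the deleted matrix. Since \<open>k < n\<close>,
    \<open>Suc ?m = n - k\<close> is the lowest order at which \<open>p\<close> is known to be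
    positive.\<close>
  let ?m = "n - 1 - k"
  have "cpoly (pderiv p) = cpoly (\<Sum>i<n. q i)"
    using pderiv_char_poly[OF A(1)] by (simp add: p q of_real_hom.map_poly_pderiv cpoly_hom.hom_sum)
  then have "pderiv p = (\<Sum>i<n. q i)" by (simp only: cpoly_hom.eq_iff)
  then have "(pderiv ^^ Suc ?m) p = (\<Sum>i<n. (pderiv ^^ ?m) (q i))"
    by (simp only: funpow_Suc_right o_apply higher_pderiv_sum)
  then have "(\<Sum>i<n. poly ((pderiv ^^ ?m) (q i)) \<mu>) = poly ((pderiv ^^ Suc ?m) p) \<mu>"
    by (simp only: poly_sum)
  also have "\<dots> > 0" using k by (intro ppos) auto
  finally have "(\<Sum>i<n. poly ((pderiv ^^ ?m) (q i)) \<mu>) > 0" .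
  then obtain i where i: "i < n" "poly ((pderiv ^^ ?m) (q i)) \<mu> > 0"
    by (meson lessThan_iff not_less sum_nonpos)
  have top: "poly ((pderiv ^^ (n - 1)) (q i)) \<mu> > 0"
  proof -
    have "degree ((pderiv ^^ (n - 1)) (q i)) = 0" by (simp add: degree_higher_pderiv deg)
    then obtain c where c: "(pderiv ^^ (n - 1)) (q i) = [:c:]" by (rule degree_eq_zeroE)
    have "lead_coeff ((pderiv ^^ (n - 1)) (q i)) > 0"
      by (rule higher_pderiv_lead_coeff_pos[OF lc]) (simp add: deg)
    then show ?thesis unfolding c by simp
  qed
  \<comment> \<open>Descent from order \<open>n - 1\<close>: at each step the Wronskian inequality
    bounds a positive product by one whose factor from \<open>p\<close> is positive. Order
    \<open>?m\<close> comes from the choice of \<open>i\<close> instead.\<close>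
  have "poly ((pderiv ^^ l) (q i)) \<mu> > 0" if "n - k \<le> l" "l \<le> n - 1" for l
    using that(2,1)
  proof (induction rule: inc_induct)
    case base
    then show ?case using top by simp
  next
    case (step l)
    have "0 < poly ((pderiv ^^ l) p) \<mu> * poly ((pderiv ^^ Suc l) (q i)) \<mu>"
      using step by (intro mult_pos_pos ppos) auto
    also have "\<dots> \<le> poly ((pderiv ^^ Suc l) p) \<mu> * poly ((pderiv ^^ l) (q i)) \<mu>"
      using step i by (intro higher_pderiv_wronskian_nonneg[OF A _ _ p q]) auto
    finally show ?case
      by (rule zero_less_mult_pos) (use step in \<open>intro ppos, auto\<close>)
  qed
  then have "poly ((pderiv ^^ l) (q i)) \<mu> > 0" if "?m \<le> l" "l \<le> n - 1" for l
    using that i(2) by (cases "l = ?m") auto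
  then show ?thesis
    using that i(1) by (simp add: q of_real_hom.map_poly_higher_pderiv[symmetric])
qed

lemma exists_submatrix_eigenvalues_less:
  assumes "A \<in> carrier_mat n n" "hermitian_mat A" "k \<le> n"
    and "\<And>l. n - k \<le> l \<Longrightarrow> l \<le> n \<Longrightarrow> Re (poly ((pderiv ^^ l) (char_poly A)) (of_real \<mu>)) > 0"
  shows "\<exists>S \<subseteq> {..<n}. card S = k \<and> (\<forall>x. eigenvalue (submatrix A S S) (complex_of_real x) \<longrightarrow> x < \<mu>)"
  using assms
proof (induction "n - k" arbitrary: n A)
  case 0
  note A = 0(2,3)
  have [simp]: "k = n" using 0 by simp
  have "submatrix A {..<n} {..<n} = A"
    using submatrix_subset_carrier[OF A(1), of "{..<n}"] A(1)
    by (intro eq_matI) (auto simp: pick_lessThan)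
  moreover have "x < \<mu>" if "eigenvalue A (complex_of_real x)" for x
  proof (rule ccontr)
    assume x: "\<not> x < \<mu>"
    obtain p where p: "char_poly A = cpoly p" "degree p = n" using hermitian_char_poly[OF A] by blast
    have ppos: "poly ((pderiv ^^ l) p) \<mu> > 0" if "l \<le> n" for l
      using 0(5)[of l] that by (simp add: p of_real_hom.map_poly_higher_pderiv[symmetric])
    have "poly ((pderiv ^^ l) p) \<mu> \<ge> 0" for l
    \<comment> \<open>Monotonicity asks for all orders; those above \<open>n\<close> give the zero
      polynomial.\<close>
    proof (cases "l \<le> n")
      case False
      then have "(pderiv ^^ l) p = 0" using p(2) by (intro poly_eqI) (simp add: coeff_higher_pderiv coeff_eq_0)
      then show ?thesis by simp
    qed (use ppos less_imp_le in blast)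
    then have "poly p x \<ge> poly p \<mu>"
      using x by (intro poly_mono_of_higher_pderiv_nonneg) auto
    then have "poly p x > 0" using ppos[of 0] by simp
    then show False using that by (simp add: eigenvalue_root_char_poly[OF A(1)] p)
  qed
  ultimately show ?case by (intro exI[of _ "{..<n}"]) simp
next
  case (Suc m)
  note A = Suc(3,4)
  have k: "k < n" using Suc(2) by simp
  obtain i where i: "i < n" "\<And>l. n - 1 - k \<le> l \<Longrightarrow> l \<le> n - 1 \<Longrightarrow>
    Re (poly ((pderiv ^^ l) (char_poly (mat_delete A i i))) (of_real \<mu>)) > 0"
    using exists_mat_delete_higher_pderiv_pos[OF A k Suc(6)] by blast
  have "\<exists>S \<subseteq> {..<n - 1}. card S = k \<and>
    (\<forall>x. eigenvalue (submatrix (mat_delete A i i) S S) (complex_of_real x) \<longrightarrow> x < \<mu>)"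
    using Suc(2) k i(2)
    by (intro Suc(1) mat_delete_carrier hermitian_mat_delete[OF A] A) auto
  then show ?case
    using submatrix_mat_delete[OF A(1) _ i(1)] by metis
qed

section \<open>Largest eigenvalue, largest root and the choice of the subset\<close>

text \<open>The \<open>Max\<close> in \<open>lambda_max\<close> is attained because the set is
  finite and, by the fundamental theorem of algebra and real-rootedness, nonempty.\<close>

lemma eigenvalue_lambda_max:
  assumes A: "A \<in> carrier_mat n n" "hermitian_mat A" and n: "n > 0"
  shows "eigenvalue A (complex_of_real (lambda_max A))"
proof -
  obtain p where p: "char_poly A = cpoly p" "degree p = n" "upper_stable (cpoly p)"
    using hermitian_char_poly[OF A] by blast
  let ?R = "{x. eigenvalue A (complex_of_real x)}"
  have R: "?R = {x. poly p x = 0}"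
    by (simp add: eigenvalue_root_char_poly[OF A(1)] p)
  have "p \<noteq> 0" using p(2) n by auto
  then have "finite ?R" unfolding R by (rule poly_roots_finite)
  moreover have "?R \<noteq> {}"
  proof -
    have "\<not> constant (poly (cpoly p))"
      using p(2) n by (simp add: constant_degree)
    then obtain z where z: "poly (cpoly p) z = 0"
      using fundamental_theorem_of_algebra by blast
    then have "poly (cpoly p) (complex_of_real (Re z)) = 0"
      using upper_stable_real_root[OF p(3)] by metis
    then show ?thesis unfolding R by (auto simp del: poly_cpoly_of_real simp: poly_cpoly_of_real[of p "Re z"])
  qed
  ultimately have "Max ?R \<in> ?R" by (rule Max_in)
  then show ?thesis unfolding lambda_max_def by simp
qed

text \<open>The derivative of order \<open>n - k\<close> is a positive multiple of a product of real
  linear factors with roots below \<mu>, so its own derivatives up to order \<open>k\<close> are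
  positive at \<mu>.\<close>

lemma higher_pderiv_pos_above_max_root:
  assumes A: "A \<in> carrier_mat n n" "hermitian_mat A" and k: "1 \<le> k" "k \<le> n"
    and \<mu>: "max_root ((pderiv ^^ (n - k)) (char_poly A)) < \<mu>" and l: "n - k \<le> l" "l \<le> n"
  shows "Re (poly ((pderiv ^^ l) (char_poly A)) (of_real \<mu>)) > 0"
proof -
  obtain p where p: "char_poly A = cpoly p" "degree p = n" "lead_coeff p = 1" "upper_stable (cpoly p)"
    using hermitian_char_poly[OF A] by blast
  let ?f = "(pderiv ^^ (n - k)) p"
  have deg: "degree ?f = k" using p(2) k by (simp add: degree_higher_pderiv)
  have lc: "lead_coeff ?f > 0" using p k by (intro higher_pderiv_lead_coeff_pos) auto
  have "upper_stable (cpoly ?f)"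
    using upper_stable_higher_pderiv[OF p(4), of "n - k"] p(2) by (simp add: of_real_hom.map_poly_higher_pderiv)
  then obtain rs where f: "?f = Polynomial.smult (lead_coeff ?f) (\<Prod>r\<leftarrow>rs. [:- r, 1:])"
    and len: "length rs = k"
    using upper_stable_real_splits deg by metis
  have roots: "{x. poly ?f x = 0} = set rs"
    using lc by (subst f) (auto simp: poly_prod_list o_def prod_list_zero_iff)
  have "max_root ((pderiv ^^ (n - k)) (char_poly A)) = Max (set rs)"
    unfolding max_root_def roots[symmetric] by (simp add: p(1) of_real_hom.map_poly_higher_pderiv[symmetric])
  then have rs: "\<forall>r\<in>set rs. r < \<mu>" using \<mu> by (auto intro: le_less_trans[OF Max_ge])
  define j where "j = l - (n - k)"
  have j: "l = j + (n - k)" "j \<le> k" using l k by (auto simp: j_def)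
  have "(pderiv ^^ l) p = (pderiv ^^ j) ?f" by (simp add: j funpow_add)
  also have "\<dots> = Polynomial.smult (lead_coeff ?f) ((pderiv ^^ j) (\<Prod>r\<leftarrow>rs. [:- r, 1:]))"
    by (subst f) (simp only: higher_pderiv_smult)
  finally have "poly ((pderiv ^^ l) p) \<mu> > 0"
    using lc higher_pderiv_prod_list_pos[OF rs, of j] j len by simp
  then show ?thesis by (simp add: p of_real_hom.map_poly_higher_pderiv[symmetric])
qed

theorem theorem1p3:
  fixes A :: "complex mat" and n k :: nat
  assumes "A \<in> carrier_mat n n"
    and "hermitian_mat A"
    and "1 \<le> k" and "k \<le> n"
  shows "\<exists>S. S \<subseteq> {..<n} \<and> card S = k \<and>
    lambda_max (submatrix A S S) \<le> max_root ((pderiv ^^ (n - k)) (char_poly A))"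
proof (rule ccontr)
  let ?M = "max_root ((pderiv ^^ (n - k)) (char_poly A))"
  let ?F = "{S. S \<subseteq> {..<n} \<and> card S = k}"
  \<comment> \<open>If every \<open>S\<close> failed, this minimum over finitely many sets would
    exceed \<open>?M\<close>. Using it as the bound itself yields an \<open>S\<close> with spectrum
    below the minimum, a contradiction without any limit.\<close>
  define \<mu> where "\<mu> = Min ((\<lambda>S. lambda_max (submatrix A S S)) ` ?F)"
  assume "\<not> ?thesis"
  then have less: "?M < lambda_max (submatrix A S S)" if "S \<in> ?F" for S
    using that not_less by auto
  have fin: "finite ?F" by simp
  have "?F \<noteq> {}" using assms(4) by (auto intro!: exI[of _ "{..<k}"])
  then have "?M < \<mu>" using less fin by (simp add: \<mu>_def)
  then obtain S where S: "S \<subseteq> {..<n}" "card S = k"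
    and ev: "\<And>x. eigenvalue (submatrix A S S) (complex_of_real x) \<Longrightarrow> x < \<mu>"
    using exists_submatrix_eigenvalues_less[OF assms(1,2,4), of \<mu>]
      higher_pderiv_pos_above_max_root[OF assms] by blast
  have "eigenvalue (submatrix A S S) (complex_of_real (lambda_max (submatrix A S S)))"
    using submatrix_subset_carrier(1)[OF assms(1) S(1)] hermitian_submatrix[OF assms(1,2) S(1)] S(2) assms(3)
    by (intro eigenvalue_lambda_max) auto
  then have "lambda_max (submatrix A S S) < \<mu>" by (rule ev)
  moreover have "\<mu> \<le> lambda_max (submatrix A S S)"
    unfolding \<mu>_def using fin S by (intro Min_le) auto
  ultimately show False by simp
qed

end
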